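(* Let $G$ be a graph, and let $\mathcal{R}(G)$ be the set of equivalence relations $\sim$ on $V(G)$ such that $\sim\triangleleft G$. Then $\mathcal{R}(G)$ is partially ordered by refinement: for $\sim,\sim'\in\mathcal{R}(G)$, $$\sim\,\leq\,\sim'\quad\text{if}\quad(\forall x,y\in V(G),\ x\sim y\Longrightarrow x\sim' y).$$ In other words, $\sim\leq\sim'$ if the equivalence classes of $\sim'$ are disjoint unions of equivalence classes of $\sim$. Then $(\mathcal{R}(G),\leq)$ is a bounded graded lattice. Its minimal element $\sim_0$ is the equality; its maximal element $\sim_1$ is the relation whose equivalence classes are the connected components of $G$.
   Context: A graph is a pair $G=(V(G),E(G))$ with $V(G)$ a finite set and $E(G)$ a set of $2$-element subsets of $V(G)$. The empty graph is considered as non connected. For an equivalence relation $\sim$ on $V(G)$, one writes $\sim\triangleleft G$ if, for every equivalence class $c$ of $\sim$, the induced subgraph $G_{|c}$ is connected. *)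

theory Defs
  imports "HOL-Algebra.Lattice" "HOL-Library.Disjoint_Sets"
begin

section \<open>Finite simple graphs\<close>

type_synonym 'a graph = "'a set \<times> 'a set set"

abbreviation verts :: "'a graph \<Rightarrow> 'a set" where
  "verts G \<equiv> fst G"

abbreviation edges :: "'a graph \<Rightarrow> 'a set set" where
  "edges G \<equiv> snd G"

definition is_graph :: "'a graph \<Rightarrow> bool" where
  "is_graph G \<longleftrightarrow> finite (verts G) \<and> edges G \<subseteq> {e. e \<subseteq> verts G \<and> card e = 2}"

definition induced :: "'a graph \<Rightarrow> 'a set \<Rightarrow> 'a graph" where
  "induced G c = (c, {e \<in> edges G. e \<subseteq> c})"

definition adj :: "'a graph \<Rightarrow> ('a \<times> 'a) set" where
  "adj G = {(x, y). {x, y} \<in> edges G}"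

text \<open>Any two vertices are joined by a (possibly trivial) path; the empty graph is not connected.\<close>

definition connected_graph :: "'a graph \<Rightarrow> bool" where
  "connected_graph G \<longleftrightarrow>
     verts G \<noteq> {} \<and> (\<forall>x \<in> verts G. \<forall>y \<in> verts G. (x, y) \<in> (adj G)\<^sup>*)"

text \<open>Connected components are represented by their vertex sets: the maximal sets of vertices
  inducing a connected subgraph.\<close>

definition components :: "'a graph \<Rightarrow> 'a set set" where
  "components G = {C. C \<subseteq> verts G \<and> connected_graph (induced G C) \<and>
     (\<forall>D. C \<subseteq> D \<and> D \<subseteq> verts G \<and> connected_graph (induced G D) \<longrightarrow> D = C)}"

section \<open>Equivalence relations with connected classes\<close>

definition classes_connected :: "('a \<times> 'a) set \<Rightarrow> 'a graph \<Rightarrow> bool" (infix \<open>\<triangleleft>\<close> 50) where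
  "r \<triangleleft> G \<longleftrightarrow> (\<forall>c \<in> verts G // r. connected_graph (induced G c))"

definition conn_equivs :: "'a graph \<Rightarrow> ('a \<times> 'a) set set" where
  "conn_equivs G = {r. equiv (verts G) r \<and> r \<triangleleft> G}"

definition refinement_order :: "'a graph \<Rightarrow> ('a \<times> 'a) set gorder" where
  "refinement_order G =
     \<lparr> carrier = conn_equivs G, eq = (=),
       le = (\<lambda>r s. \<forall>x \<in> verts G. \<forall>y \<in> verts G. (x, y) \<in> r \<longrightarrow> (x, y) \<in> s) \<rparr>"

definition same_component :: "'a graph \<Rightarrow> ('a \<times> 'a) set" where
  "same_component G = {(x, y). \<exists>C \<in> components G. x \<in> C \<and> y \<in> C}"

section \<open>Graded posets\<close>

definition covers :: "('b, 'c) gorder_scheme \<Rightarrow> 'b \<Rightarrow> 'b \<Rightarrow> bool" where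
  "covers L y x \<longleftrightarrow> x \<sqsubset>\<^bsub>L\<^esub> y \<and> (\<nexists>z. z \<in> carrier L \<and> x \<sqsubset>\<^bsub>L\<^esub> z \<and> z \<sqsubset>\<^bsub>L\<^esub> y)"

text \<open>A poset is graded if it has a rank function: strictly increasing, and increasing by
  exactly one along covering relations. For bounded posets of finite length this amounts to all
  maximal chains having the same length.\<close>

definition graded :: "('b, 'c) gorder_scheme \<Rightarrow> bool" where
  "graded L \<longleftrightarrow> (\<exists>\<rho> :: 'b \<Rightarrow> nat.
     (\<forall>x \<in> carrier L. \<forall>y \<in> carrier L. x \<sqsubset>\<^bsub>L\<^esub> y \<longrightarrow> \<rho> x < \<rho> y) \<and>
     (\<forall>x \<in> carrier L. \<forall>y \<in> carrier L. covers L y x \<longrightarrow> \<rho> y = Suc (\<rho> x)))"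

end

theory Submission
  imports Defs
begin

text \<open>
  An equivalence relation has connected classes exactly when it is generated by edges: two related
  vertices can always be joined by a path whose consecutive vertices are themselves related
  (\<open>conn_equivs_iff_paths\<close>). Conversely, every symmetric relation \<open>A\<close> generates such an
  equivalence relation, namely joinability by paths whose edges all lie in \<open>A\<close>. This passage from
  \<open>A\<close> to \<open>linked G A\<close> is monotone and fixes the elements of \<open>\<R>(G)\<close>. Hence the join of \<open>r\<close> and \<open>s\<close>
  is \<open>linked G (r \<union> s)\<close>, and the greatest element arises from taking all edges. The meet is
  \<open>linked G (r \<inter> s)\<close>; it is in general smaller than the intersection, whose classes need not
  be connected.

  The rank of \<open>r\<close> is the number of vertices minus the number of classes. It is strictly increasing
  because a proper coarsening of a partition of a finite set has fewer blocks. If \<open>s\<close> covers \<open>r\<close>,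
  some edge \<open>x y\<close> of \<open>G\<close> is related by \<open>s\<close> but not by \<open>r\<close>, since otherwise the paths that generate \<open>s\<close>
  would lie in \<open>r\<close>. Merging the classes of \<open>x\<close> and \<open>y\<close> in \<open>r\<close> gives an element of \<open>\<R>(G)\<close> strictly
  above \<open>r\<close> and below \<open>s\<close>. It therefore equals \<open>s\<close>, so \<open>s\<close> has exactly one class fewer than \<open>r\<close>.
\<close>

section \<open>Partitions of a finite set\<close>

text \<open>Sending each class to the class containing it is onto; two distinct classes of the finer
  relation that lie in a common class of the coarser one witness that it is not injective.\<close>

lemma card_quotient_less_of_psubset:
  assumes "finite A" "equiv A r" "equiv A s" "r \<subset> s"
  shows "card (A // s) < card (A // r)"
proof -
  have img: "(\<lambda>c. s `` c) ` (A // r) = A // s"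
    using assms by (intro refines_equiv_image_eq) auto
  have fin: "finite (A // r)"
    using assms by (simp add: finite_quotient equiv_type)
  obtain x y where xy: "(x, y) \<in> s" "(x, y) \<notin> r"
    using assms by auto
  then have A: "x \<in> A" "y \<in> A"
    using assms(3) by (auto dest: equiv_type)
  have "r `` {x} \<noteq> r `` {y}"
    using A xy(2) assms(2) by (simp add: eq_equiv_class_iff)
  moreover have "s `` (r `` {x}) = s `` (r `` {y})"
    using assms xy(1) by (simp add: refines_equiv_class_eq2 equiv_class_eq psubset_imp_subset)
  ultimately have "\<not> inj_on (\<lambda>c. s `` c) (A // r)"
    using A by (meson inj_onD quotientI)
  then have "card ((\<lambda>c. s `` c) ` (A // r)) < card (A // r)"
    using fin card_image_le eq_card_imp_inj_on le_neq_implies_less by blast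
  then show ?thesis
    using img by simp
qed

definition merge_classes :: "('a \<times> 'a) set \<Rightarrow> 'a \<Rightarrow> 'a \<Rightarrow> ('a \<times> 'a) set" where
  "merge_classes r x y = r \<union> r `` {x} \<times> r `` {y} \<union> r `` {y} \<times> r `` {x}"

lemma equiv_merge_classes:
  assumes "equiv A r"
  shows "equiv A (merge_classes r x y)"
proof -
  have r: "r \<subseteq> A \<times> A" "refl_on A r" "sym r" "trans r"
    using assms by (auto elim: equivE)
  have mem: "(a, b) \<in> merge_classes r x y \<longleftrightarrow>
      (a, b) \<in> r \<or> (x, a) \<in> r \<and> (y, b) \<in> r \<or> (y, a) \<in> r \<and> (x, b) \<in> r" for a b
    by (auto simp: merge_classes_def)
  show ?thesis
  proof (rule equivI)
    show "merge_classes r x y \<subseteq> A \<times> A"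
      using r(1) by (auto simp: merge_classes_def)
    show "refl_on A (merge_classes r x y)"
      using r(2) by (simp add: mem refl_on_def)
    show "sym (merge_classes r x y)"
      using r(3) unfolding sym_def mem by blast
    show "trans (merge_classes r x y)"
    proof (rule transI)
      fix a b c assume "(a, b) \<in> merge_classes r x y" "(b, c) \<in> merge_classes r x y"
      then show "(a, c) \<in> merge_classes r x y"
        unfolding mem using symD[OF r(3)] transD[OF r(4)] by (smt (verit, ccfv_threshold))
    qed
  qed
qed

text \<open>Away from the class of \<open>y\<close>, distinct classes remain distinct after the merger, so at most one
  class is lost.\<close>

lemma card_quotient_le_Suc_merge_classes:
  assumes "finite A" "equiv A r" "y \<in> A"
  shows "card (A // r) \<le> Suc (card (A // merge_classes r x y))"
proof -
  let ?t = "merge_classes r x y" and ?Y = "r `` {y}"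
  have t: "equiv A ?t"
    using assms(2) by (rule equiv_merge_classes)
  have fin: "finite (A // r)" "finite (A // ?t)"
    using assms t by (simp_all add: finite_quotient equiv_type)
  have img: "?t `` (r `` {u}) = ?t `` {u}" for u
    using assms(2) t by (intro refines_equiv_class_eq2) (auto simp: merge_classes_def)
  have "inj_on (\<lambda>c. ?t `` c) (A // r - {?Y})"
  proof (rule inj_onI)
    fix c d
    assume c: "c \<in> A // r - {?Y}" and d: "d \<in> A // r - {?Y}" and eq: "?t `` c = ?t `` d"
    obtain u where u: "u \<in> A" "c = r `` {u}"
      using c by (auto elim: quotientE)
    obtain v where v: "v \<in> A" "d = r `` {v}"
      using d by (auto elim: quotientE)
    have "(u, v) \<in> ?t"
      using eq u v img t by (simp add: eq_equiv_class_iff)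
    moreover have "(y, u) \<notin> r" "(y, v) \<notin> r"
      using c d u v assms(2) by (auto dest: equiv_class_eq)
    ultimately have "(u, v) \<in> r"
      by (auto simp: merge_classes_def)
    then show "c = d"
      using u v assms(2) by (auto dest: equiv_class_eq)
  qed
  moreover have "(\<lambda>c. ?t `` c) ` (A // r - {?Y}) \<subseteq> A // ?t"
    using img by (auto elim!: quotientE intro: quotientI)
  ultimately have "card (A // r - {?Y}) \<le> card (A // ?t)"
    using fin(2) by (rule card_inj_on_le)
  then show ?thesis
    using card_Suc_Diff1[OF fin(1) quotientI[OF assms(3), of r]] by linarith
qed

text \<open>The union in the condition on the right can always be taken over all \<open>r\<close>-classes contained in the
  given \<open>s\<close>-class.\<close>

lemma equiv_subset_iff_classes_unions:
  assumes r: "equiv A r" and s: "equiv A s"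
  shows "r \<subseteq> s \<longleftrightarrow> (\<forall>c \<in> A // s. \<exists>\<C> \<subseteq> A // r. disjoint \<C> \<and> c = \<Union>\<C>)"
proof
  assume sub: "r \<subseteq> s"
  show "\<forall>c \<in> A // s. \<exists>\<C> \<subseteq> A // r. disjoint \<C> \<and> c = \<Union>\<C>"
  proof
    fix c assume c: "c \<in> A // s"
    let ?C = "{d \<in> A // r. d \<subseteq> c}"
    have "disjoint ?C"
      using quotient_disj[OF r] by (auto simp: disjoint_def)
    moreover have "c \<subseteq> \<Union>?C"
    proof
      fix x assume x: "x \<in> c"
      then have "x \<in> A"
        using c in_quotient_imp_subset[OF s] by blast
      moreover have "r `` {x} \<subseteq> c"
        using sub in_quotient_imp_closed[OF s c x] by blast
      ultimately show "x \<in> \<Union>?C"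
        using equiv_class_self[OF r] quotientI by fastforce
    qed
    ultimately show "\<exists>\<C> \<subseteq> A // r. disjoint \<C> \<and> c = \<Union>\<C>"
      by (intro exI[of _ ?C]) blast
  qed
next
  assume un: "\<forall>c \<in> A // s. \<exists>\<C> \<subseteq> A // r. disjoint \<C> \<and> c = \<Union>\<C>"
  show "r \<subseteq> s"
  proof (rule subrelI)
    fix x y assume xy: "(x, y) \<in> r"
    then have "x \<in> A"
      using equiv_type[OF r] by blast
    then obtain \<C> where C: "\<C> \<subseteq> A // r" "s `` {x} = \<Union>\<C>"
      using un quotientI[of x A s] by auto
    then obtain d where d: "d \<in> \<C>" "x \<in> d"
      using equiv_class_self[OF s \<open>x \<in> A\<close>] by blast
    then have "y \<in> d"
      using C xy in_quotient_imp_closed[OF r] by blast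
    then show "(x, y) \<in> s"
      using C d by blast
  qed
qed

section \<open>Equivalence relations generated by edges\<close>

lemma sym_adj: "sym (adj G)"
  by (simp add: adj_def sym_def insert_commute)

lemma adj_subset_verts:
  assumes "is_graph G"
  shows "adj G \<subseteq> verts G \<times> verts G"
  using assms unfolding is_graph_def adj_def by fastforce

lemma adj_induced: "adj (induced G c) = adj G \<inter> c \<times> c"
  by (auto simp: adj_def induced_def)

lemma verts_induced [simp]: "verts (induced G c) = c"
  by (simp add: induced_def)

text \<open>A path along related vertices stays in the class of its starting point, so the paths inside
  classes and the paths inside \<open>r\<close> are the same.\<close>

lemma conn_equivs_iff_paths:
  "r \<in> conn_equivs G \<longleftrightarrow> equiv (verts G) r \<and> r \<subseteq> (adj G \<inter> r)\<^sup>*"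
proof (intro iffI conjI)
  assume "r \<in> conn_equivs G"
  then have r: "equiv (verts G) r" and conn: "r \<triangleleft> G"
    by (simp_all add: conn_equivs_def)
  show "equiv (verts G) r" by fact
  show "r \<subseteq> (adj G \<inter> r)\<^sup>*"
  proof (rule subrelI)
    fix x y assume xy: "(x, y) \<in> r"
    let ?c = "r `` {x}"
    have x: "x \<in> verts G"
      using xy equiv_type[OF r] by blast
    then have "connected_graph (induced G ?c)"
      using conn by (simp add: classes_connected_def quotientI)
    then have "(x, y) \<in> (adj G \<inter> ?c \<times> ?c)\<^sup>*"
      using xy equiv_class_self[OF r x] by (simp add: connected_graph_def adj_induced)
    moreover have "?c \<times> ?c \<subseteq> r"
      using r by (blast elim: equivE dest: symD transD)
    ultimately show "(x, y) \<in> (adj G \<inter> r)\<^sup>*"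
      by (meson Int_mono order_refl rtrancl_mono subsetD)
  qed
next
  assume r: "equiv (verts G) r \<and> r \<subseteq> (adj G \<inter> r)\<^sup>*"
  have "connected_graph (induced G c)" if c: "c \<in> verts G // r" for c
  proof -
    have "(y, z) \<in> (adj G \<inter> c \<times> c)\<^sup>*" if y: "y \<in> c" and z: "z \<in> c" for y z
    proof -
      have "(y, z) \<in> (adj G \<inter> r)\<^sup>*"
        using r c y z in_quotient_imp_in_rel by fast
      then have "z \<in> c \<and> (y, z) \<in> (adj G \<inter> c \<times> c)\<^sup>*"
      proof (induction rule: rtrancl_induct)
        case base
        then show ?case using y by simp
      next
        case (step u v)
        then have "v \<in> c"
          using r c in_quotient_imp_closed by fast
        then show ?case
          using step by (auto intro: rtrancl_into_rtrancl)
      qed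
      then show ?thesis ..
    qed
    then show ?thesis
      using r c in_quotient_imp_non_empty
      by (fastforce simp: connected_graph_def adj_induced)
  qed
  then show "r \<in> conn_equivs G"
    using r by (simp add: conn_equivs_def classes_connected_def)
qed

text \<open>The restriction to \<open>verts G\<close> removes the trivial paths at points that are not vertices.\<close>

definition linked :: "'a graph \<Rightarrow> ('a \<times> 'a) set \<Rightarrow> ('a \<times> 'a) set" where
  "linked G A = (adj G \<inter> A)\<^sup>* \<inter> verts G \<times> verts G"

lemma linked_mono: "A \<subseteq> B \<Longrightarrow> linked G A \<subseteq> linked G B"
  unfolding linked_def by (meson Int_mono order_refl rtrancl_mono)

lemma linked_subset_equiv:
  assumes "equiv (verts G) r"
  shows "linked G r \<subseteq> r"
proof (rule subrelI)
  fix x y assume "(x, y) \<in> linked G r"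
  then have "(x, y) \<in> (adj G \<inter> r)\<^sup>*" "x \<in> verts G"
    by (auto simp: linked_def)
  then show "(x, y) \<in> r"
  proof (induction rule: rtrancl_induct)
    case base
    then show ?case using assms by (auto elim: equivE dest: refl_onD)
  next
    case (step u v)
    then show ?case using assms by (auto elim: equivE dest: transD)
  qed
qed

lemma linked_eq_self:
  assumes "r \<in> conn_equivs G"
  shows "linked G r = r"
proof
  show "linked G r \<subseteq> r"
    using assms by (simp add: linked_subset_equiv conn_equivs_def)
  show "r \<subseteq> linked G r"
    using assms equiv_type by (auto simp: linked_def conn_equivs_iff_paths)
qed

text \<open>Each edge of \<open>G\<close> that lies in \<open>A\<close> is itself a path of length one, so its two ends are linked.
  A path in \<open>A\<close> is therefore also a path in \<open>linked G A\<close>.\<close>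

lemma linked_in_conn_equivs:
  assumes G: "is_graph G" and A: "sym A"
  shows "linked G A \<in> conn_equivs G"
proof -
  have "sym ((adj G \<inter> A)\<^sup>*)"
    using A sym_adj by (intro sym_rtrancl sym_Int)
  then have "equiv (verts G) (linked G A)"
    by (auto simp: linked_def intro!: equivI refl_onI symI transI dest: symD intro: rtrancl_trans)
  moreover have "adj G \<inter> A \<subseteq> linked G A"
    using adj_subset_verts[OF G] by (auto simp: linked_def)
  then have "linked G A \<subseteq> (adj G \<inter> linked G A)\<^sup>*"
    using rtrancl_mono[of "adj G \<inter> A" "adj G \<inter> linked G A"] by (auto simp: linked_def)
  ultimately show ?thesis
    by (simp add: conn_equivs_iff_paths)
qed

section \<open>Connected components\<close>

lemma linked_UNIV_in_conn_equivs: "is_graph G \<Longrightarrow> linked G UNIV \<in> conn_equivs G"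
  by (simp add: linked_in_conn_equivs sym_def)

text \<open>The classes of \<open>linked G UNIV\<close> are connected, so this makes them the maximal connected vertex
  sets.\<close>

lemma connected_subset_linked_class:
  assumes "connected_graph (induced G D)" "D \<subseteq> verts G" "x \<in> D"
  shows "D \<subseteq> linked G UNIV `` {x}"
proof
  fix y assume "y \<in> D"
  then have "(x, y) \<in> (adj G \<inter> D \<times> D)\<^sup>*"
    using assms by (simp add: connected_graph_def adj_induced)
  then have "(x, y) \<in> (adj G)\<^sup>*"
    by (meson Int_lower1 rtrancl_mono subsetD)
  then show "y \<in> linked G UNIV `` {x}"
    using assms \<open>y \<in> D\<close> by (auto simp: linked_def)
qed

lemma quotient_linked_UNIV:
  assumes "is_graph G"
  shows "verts G // linked G UNIV = components G"
proof (intro Set.set_eqI iffI)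
  let ?r = "linked G UNIV"
  have R: "?r \<in> conn_equivs G"
    using assms by (rule linked_UNIV_in_conn_equivs)
  then have r: "equiv (verts G) ?r" and conn: "\<And>c. c \<in> verts G // ?r \<Longrightarrow> connected_graph (induced G c)"
    by (simp_all add: conn_equivs_def classes_connected_def)
  {
    fix C assume C: "C \<in> verts G // ?r"
    then obtain x where x: "x \<in> verts G" "C = ?r `` {x}"
      by (auto elim: quotientE)
    then have "D = C" if "C \<subseteq> D" "D \<subseteq> verts G" "connected_graph (induced G D)" for D
      using that connected_subset_linked_class[of G D x] equiv_class_self[OF r x(1)] by blast
    then show "C \<in> components G"
      using conn[OF C] in_quotient_imp_subset[OF r C] by (auto simp: components_def)
  next
    fix C assume "C \<in> components G"
    then have sub: "C \<subseteq> verts G" and con: "connected_graph (induced G C)"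
      and max: "\<And>D. C \<subseteq> D \<Longrightarrow> D \<subseteq> verts G \<Longrightarrow> connected_graph (induced G D) \<Longrightarrow> D = C"
      by (auto simp: components_def)
    obtain x where x: "x \<in> C"
      using con by (auto simp: connected_graph_def)
    then have class_x: "?r `` {x} \<in> verts G // ?r"
      using sub by (auto intro: quotientI)
    then have "?r `` {x} = C"
      using max connected_subset_linked_class[OF con sub x] conn in_quotient_imp_subset[OF r] by blast
    then show "C \<in> verts G // ?r"
      using class_x by simp
  }
qed

lemma same_component_eq_linked:
  assumes "is_graph G"
  shows "same_component G = linked G UNIV"
proof -
  have r: "equiv (verts G) (linked G UNIV)"
    using linked_UNIV_in_conn_equivs[OF assms] by (simp add: conn_equivs_def)
  have "(x, y) \<in> linked G UNIV \<longleftrightarrow> (\<exists>C \<in> verts G // linked G UNIV. x \<in> C \<and> y \<in> C)" for x y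
  proof
    assume xy: "(x, y) \<in> linked G UNIV"
    then have "x \<in> verts G"
      using equiv_type[OF r] by blast
    then show "\<exists>C \<in> verts G // linked G UNIV. x \<in> C \<and> y \<in> C"
      using xy equiv_class_self[OF r] by (intro bexI[of _ "linked G UNIV `` {x}"] quotientI) auto
  next
    assume "\<exists>C \<in> verts G // linked G UNIV. x \<in> C \<and> y \<in> C"
    then show "(x, y) \<in> linked G UNIV"
      using in_quotient_imp_in_rel[OF r] by fast
  qed
  then show ?thesis
    by (auto simp: same_component_def quotient_linked_UNIV[OF assms])
qed

section \<open>The lattice of equivalence relations with connected classes\<close>

lemma conn_equivs_subset_verts: "r \<in> conn_equivs G \<Longrightarrow> r \<subseteq> verts G \<times> verts G"
  by (auto simp: conn_equivs_def dest: equiv_type)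

lemma carrier_refinement_order [simp]: "carrier (refinement_order G) = conn_equivs G"
  by (simp add: refinement_order_def)

lemma le_refinement_order_iff:
  assumes "r \<in> conn_equivs G"
  shows "r \<sqsubseteq>\<^bsub>refinement_order G\<^esub> s \<longleftrightarrow> r \<subseteq> s"
  using conn_equivs_subset_verts[OF assms] by (auto simp: refinement_order_def)

lemma lless_refinement_order_iff:
  assumes "r \<in> conn_equivs G"
  shows "r \<sqsubset>\<^bsub>refinement_order G\<^esub> s \<longleftrightarrow> r \<subset> s"
  using le_refinement_order_iff[OF assms, of s]
  by (auto simp: lless_def refinement_order_def)

lemma partial_order_refinement_order: "partial_order (refinement_order G)"
proof
  show "(.=\<^bsub>refinement_order G\<^esub>) = (=)"
    by (simp add: refinement_order_def)
qed (auto simp: le_refinement_order_iff, auto simp: refinement_order_def)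

lemma least_refinement_order:
  "least (refinement_order G) (Id_on (verts G)) (conn_equivs G)"
proof -
  have "equiv (verts G) (Id_on (verts G))"
    by (auto simp: equiv_def refl_on_def sym_def trans_def)
  then have "Id_on (verts G) \<in> conn_equivs G"
    by (auto simp: conn_equivs_iff_paths)
  then show ?thesis
    by (auto simp: least_def le_refinement_order_iff conn_equivs_def elim!: equivE dest: refl_onD)
qed

lemma greatest_refinement_order:
  assumes "is_graph G"
  shows "greatest (refinement_order G) (same_component G) (conn_equivs G)"
  unfolding greatest_def same_component_eq_linked[OF assms]
  using linked_UNIV_in_conn_equivs[OF assms] linked_mono[of _ UNIV G] linked_eq_self
  by (fastforce simp: le_refinement_order_iff)

lemma sym_of_conn_equivs: "r \<in> conn_equivs G \<Longrightarrow> sym r"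
  by (auto simp: conn_equivs_def elim: equivE)

lemma least_Upper_linked_Un:
  assumes G: "is_graph G" and r: "r \<in> conn_equivs G" and s: "s \<in> conn_equivs G"
  shows "least (refinement_order G) (linked G (r \<union> s)) (Upper (refinement_order G) {r, s})"
proof -
  have join: "linked G (r \<union> s) \<in> conn_equivs G"
    using G sym_Un[OF sym_of_conn_equivs[OF r] sym_of_conn_equivs[OF s]]
    by (rule linked_in_conn_equivs)
  have "r \<subseteq> linked G (r \<union> s)"
    using linked_mono[of r "r \<union> s" G, OF Un_upper1] unfolding linked_eq_self[OF r] .
  moreover have "s \<subseteq> linked G (r \<union> s)"
    using linked_mono[of s "r \<union> s" G, OF Un_upper2] unfolding linked_eq_self[OF s] .
  moreover have "linked G (r \<union> s) \<subseteq> t" if "t \<in> conn_equivs G" "r \<subseteq> t" "s \<subseteq> t" for t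
    using linked_mono[OF Un_least[OF that(2,3)], of G] unfolding linked_eq_self[OF that(1)] .
  ultimately show ?thesis
    using r s join by (simp add: least_def Upper_def le_refinement_order_iff)
qed

lemma greatest_Lower_linked_Int:
  assumes G: "is_graph G" and r: "r \<in> conn_equivs G" and s: "s \<in> conn_equivs G"
  shows "greatest (refinement_order G) (linked G (r \<inter> s)) (Lower (refinement_order G) {r, s})"
proof -
  have meet: "linked G (r \<inter> s) \<in> conn_equivs G"
    using G sym_Int[OF sym_of_conn_equivs[OF r] sym_of_conn_equivs[OF s]]
    by (rule linked_in_conn_equivs)
  have below: "linked G (r \<inter> s) \<subseteq> r" "linked G (r \<inter> s) \<subseteq> s"
    using linked_mono[of "r \<inter> s" r G, OF Int_lower1] linked_mono[of "r \<inter> s" s G, OF Int_lower2]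
    unfolding linked_eq_self[OF r] linked_eq_self[OF s] .
  have above: "t \<subseteq> linked G (r \<inter> s)" if "t \<in> conn_equivs G" "t \<subseteq> r" "t \<subseteq> s" for t
    using linked_mono[OF Int_greatest[OF that(2,3)], of G] unfolding linked_eq_self[OF that(1)] .
  show ?thesis
    unfolding greatest_def
  proof (intro conjI ballI)
    show "linked G (r \<inter> s) \<in> Lower (refinement_order G) {r, s}"
      using meet below by (auto simp: Lower_def le_refinement_order_iff)
    fix t assume t: "t \<in> Lower (refinement_order G) {r, s}"
    then have "t \<in> conn_equivs G"
      by (simp add: Lower_def)
    moreover from this have "t \<subseteq> r" "t \<subseteq> s"
      using t r s by (simp_all add: Lower_def flip: le_refinement_order_iff)
    ultimately show "t \<sqsubseteq>\<^bsub>refinement_order G\<^esub> linked G (r \<inter> s)"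
      by (simp add: le_refinement_order_iff above)
  qed (simp add: Lower_def)
qed

lemma bounded_lattice_refinement_order:
  assumes G: "is_graph G"
  shows "bounded_lattice (refinement_order G)"
proof -
  let ?L = "refinement_order G"
  interpret partial_order ?L
    by (rule partial_order_refinement_order)
  show ?thesis
  proof
    fix r s assume rs: "r \<in> carrier ?L" "s \<in> carrier ?L"
    show "\<exists>t. least ?L t (Upper ?L {r, s})"
      by (rule exI, rule least_Upper_linked_Un[OF G rs[unfolded carrier_refinement_order]])
    show "\<exists>t. greatest ?L t (Lower ?L {r, s})"
      by (rule exI, rule greatest_Lower_linked_Int[OF G rs[unfolded carrier_refinement_order]])
  next
    show "\<exists>r. least ?L r (carrier ?L)"
      unfolding carrier_refinement_order by (rule exI, rule least_refinement_order)
    show "\<exists>r. greatest ?L r (carrier ?L)"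
      unfolding carrier_refinement_order by (rule exI, rule greatest_refinement_order[OF G])
  qed
qed

section \<open>The rank function\<close>

text \<open>The edge between \<open>x\<close> and \<open>y\<close> bridges the two merged classes, inside which paths already
  exist.\<close>

lemma merge_classes_in_conn_equivs:
  assumes r: "r \<in> conn_equivs G" and xy: "(x, y) \<in> adj G" "x \<in> verts G" "y \<in> verts G"
  shows "merge_classes r x y \<in> conn_equivs G"
proof -
  let ?t = "merge_classes r x y"
  have eq: "equiv (verts G) r"
    using r by (simp add: conn_equivs_def)
  then have refl: "(x, x) \<in> r" "(y, y) \<in> r" and "sym r"
    using xy by (simp_all add: equiv_def refl_on_def)
  have "r \<subseteq> (adj G \<inter> r)\<^sup>*"
    using r by (simp add: conn_equivs_iff_paths)
  also have "\<dots> \<subseteq> (adj G \<inter> ?t)\<^sup>*"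
    by (rule rtrancl_mono) (auto simp: merge_classes_def)
  finally have path: "r \<subseteq> (adj G \<inter> ?t)\<^sup>*" .
  have "(x, y) \<in> adj G \<inter> ?t" "(y, x) \<in> adj G \<inter> ?t"
    using xy(1) refl symD[OF sym_adj xy(1)] by (simp_all add: merge_classes_def)
  then have bridge: "(x, y) \<in> (adj G \<inter> ?t)\<^sup>*" "(y, x) \<in> (adj G \<inter> ?t)\<^sup>*"
    by (simp_all add: r_into_rtrancl)
  have "?t \<subseteq> (adj G \<inter> ?t)\<^sup>*"
  proof (rule subrelI)
    fix a b assume "(a, b) \<in> ?t"
    then consider "(a, b) \<in> r" | "(x, a) \<in> r" "(y, b) \<in> r" | "(y, a) \<in> r" "(x, b) \<in> r"
      by (auto simp: merge_classes_def)
    then show "(a, b) \<in> (adj G \<inter> ?t)\<^sup>*"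
    proof cases
      case 1
      then show ?thesis using path by (rule set_mp[rotated])
    next
      case 2
      have "(a, x) \<in> (adj G \<inter> ?t)\<^sup>*"
        by (rule subsetD[OF path symD[OF \<open>sym r\<close> 2(1)]])
      moreover have "(y, b) \<in> (adj G \<inter> ?t)\<^sup>*"
        by (rule subsetD[OF path 2(2)])
      ultimately show ?thesis
        using bridge(1) by (metis rtrancl_trans)
    next
      case 3
      have "(a, y) \<in> (adj G \<inter> ?t)\<^sup>*"
        by (rule subsetD[OF path symD[OF \<open>sym r\<close> 3(1)]])
      moreover have "(x, b) \<in> (adj G \<inter> ?t)\<^sup>*"
        by (rule subsetD[OF path 3(2)])
      ultimately show ?thesis
        using bridge(2) by (metis rtrancl_trans)
    qed
  qed
  then show ?thesis
    using equiv_merge_classes[OF eq] by (simp add: conn_equivs_iff_paths)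
qed

text \<open>Merging two classes of \<open>r\<close> along any edge in \<open>s\<close> but not in \<open>r\<close> gives a relation between \<open>r\<close> and
  \<open>s\<close>, different from \<open>r\<close>; as nothing lies strictly between, it is \<open>s\<close>.\<close>

lemma cover_is_merge_of_adjacent_classes:
  assumes G: "is_graph G" and r: "r \<in> conn_equivs G" and s: "s \<in> conn_equivs G"
    and cov: "covers (refinement_order G) s r"
  obtains x y where "x \<in> verts G" "y \<in> verts G" "s = merge_classes r x y"
proof -
  have rs: "r \<subset> s"
    using cov r by (simp add: covers_def lless_refinement_order_iff)
  have eq: "equiv (verts G) r" "equiv (verts G) s"
    using r s by (simp_all add: conn_equivs_def)
  \<comment> \<open>\<open>s\<close> is generated by its edges, so it cannot exceed \<open>r\<close> without an edge outside \<open>r\<close>.\<close>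
  have "\<not> adj G \<inter> s \<subseteq> r"
  proof
    assume "adj G \<inter> s \<subseteq> r"
    then have "adj G \<inter> s \<subseteq> adj G \<inter> r"
      by blast
    then have "(adj G \<inter> s)\<^sup>* \<subseteq> (adj G \<inter> r)\<^sup>*"
      by (rule rtrancl_mono)
    then have "linked G s \<subseteq> linked G r"
      unfolding linked_def by blast
    then show False
      using rs unfolding linked_eq_self[OF r] linked_eq_self[OF s] by blast
  qed
  then obtain x y where xy: "(x, y) \<in> adj G" "(x, y) \<in> s" "(x, y) \<notin> r"
    by auto
  then have V: "x \<in> verts G" "y \<in> verts G"
    using adj_subset_verts[OF G] by auto
  let ?t = "merge_classes r x y"
  have t: "?t \<in> conn_equivs G"
    using r xy(1) V by (rule merge_classes_in_conn_equivs)
  have "(x, x) \<in> r" "(y, y) \<in> r"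
    using eq(1) V by (simp_all add: equiv_def refl_on_def)
  then have "r \<subset> ?t"
    using xy by (auto simp: merge_classes_def)
  moreover have "?t \<subseteq> s"
  proof -
    have "sym s" "trans s"
      using eq(2) by (simp_all add: equiv_def)
    have cross: "(a, b) \<in> s" if "(x, a) \<in> r" "(y, b) \<in> r" for a b
    proof -
      have "(x, a) \<in> s" "(y, b) \<in> s"
        using that rs by auto
      then show ?thesis
        using xy(2) symD[OF \<open>sym s\<close>] transD[OF \<open>trans s\<close>] by metis
    qed
    show ?thesis
    proof (rule subrelI)
      fix a b assume "(a, b) \<in> ?t"
      then consider "(a, b) \<in> r" | "(x, a) \<in> r" "(y, b) \<in> r" | "(x, b) \<in> r" "(y, a) \<in> r"
        by (auto simp: merge_classes_def)
      then show "(a, b) \<in> s"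
      proof cases
        case 1
        then show ?thesis using rs by blast
      next
        case 2
        then show ?thesis by (rule cross)
      next
        case 3
        then show ?thesis by (rule symD[OF \<open>sym s\<close> cross])
      qed
    qed
  qed
  ultimately have "s = ?t"
    using cov r t by (auto simp: covers_def lless_refinement_order_iff)
  then show thesis
    using V that by blast
qed

lemma graded_refinement_order:
  assumes G: "is_graph G"
  shows "graded (refinement_order G)"
proof -
  let ?L = "refinement_order G"
  let ?\<rho> = "\<lambda>r. card (verts G) - card (verts G // r)"
  have fin: "finite (verts G)"
    using G by (simp add: is_graph_def)
  have le: "card (verts G // r) \<le> card (verts G)" for r
  proof -
    have "verts G // r = (\<lambda>x. r `` {x}) ` verts G"
      by (auto simp: quotient_def)
    then show ?thesis
      using card_image_le[OF fin] by simp
  qed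
  have less: "card (verts G // s) < card (verts G // r)"
    if "r \<in> conn_equivs G" "s \<in> conn_equivs G" "r \<sqsubset>\<^bsub>?L\<^esub> s" for r s
  proof (rule card_quotient_less_of_psubset[OF fin])
    show "equiv (verts G) r" "equiv (verts G) s"
      using that(1,2) by (simp_all add: conn_equivs_def)
    show "r \<subset> s"
      using that(3) unfolding lless_refinement_order_iff[OF that(1)] .
  qed
  have strict: "?\<rho> r < ?\<rho> s" if "r \<in> conn_equivs G" "s \<in> conn_equivs G" "r \<sqsubset>\<^bsub>?L\<^esub> s" for r s
    using diff_less_mono2[OF less[OF that] less_le_trans[OF less[OF that] le[of r]]] .
  have step: "?\<rho> s = Suc (?\<rho> r)"
    if r: "r \<in> conn_equivs G" and s: "s \<in> conn_equivs G" and cov: "covers ?L s r" for r s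
  proof -
    obtain x y where y: "x \<in> verts G" "y \<in> verts G" and merge: "s = merge_classes r x y"
      using cover_is_merge_of_adjacent_classes[OF G r s cov] .
    have "equiv (verts G) r"
      using r by (simp add: conn_equivs_def)
    then have "card (verts G // r) \<le> Suc (card (verts G // s))"
      unfolding merge using y(2) by (rule card_quotient_le_Suc_merge_classes[OF fin])
    moreover have "card (verts G // s) < card (verts G // r)"
      using cov unfolding covers_def by (intro less[OF r s]) (rule conjunct1)
    ultimately show ?thesis
      using le[of r] by linarith
  qed
  show ?thesis
    unfolding graded_def carrier_refinement_order
  proof (rule exI[of _ ?\<rho>], intro conjI ballI impI)
    fix r s assume "r \<in> conn_equivs G" "s \<in> conn_equivs G" "r \<sqsubset>\<^bsub>?L\<^esub> s"
    then show "?\<rho> r < ?\<rho> s"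
      by (rule strict)
  next
    fix r s assume "r \<in> conn_equivs G" "s \<in> conn_equivs G" "covers ?L s r"
    then show "?\<rho> s = Suc (?\<rho> r)"
      by (rule step)
  qed
qed

theorem proposition2p9:
  fixes G :: "'a graph"
  assumes "is_graph G"
  shows "partial_order (refinement_order G) \<and>
    (\<forall>r \<in> conn_equivs G. \<forall>s \<in> conn_equivs G.
       r \<sqsubseteq>\<^bsub>refinement_order G\<^esub> s \<longleftrightarrow>
       (\<forall>c \<in> verts G // s. \<exists>\<C> \<subseteq> verts G // r. disjoint \<C> \<and> c = \<Union>\<C>)) \<and>
    bounded_lattice (refinement_order G) \<and>
    graded (refinement_order G) \<and>
    least (refinement_order G) (Id_on (verts G)) (conn_equivs G) \<and>
    greatest (refinement_order G) (same_component G) (conn_equivs G) \<and>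
    verts G // same_component G = components G"
proof (intro conjI ballI)
  fix r s assume r: "r \<in> conn_equivs G" and s: "s \<in> conn_equivs G"
  then show "r \<sqsubseteq>\<^bsub>refinement_order G\<^esub> s \<longleftrightarrow>
       (\<forall>c \<in> verts G // s. \<exists>\<C> \<subseteq> verts G // r. disjoint \<C> \<and> c = \<Union>\<C>)"
    unfolding le_refinement_order_iff[OF r]
    by (intro equiv_subset_iff_classes_unions) (simp_all add: conn_equivs_def)
next
  show "verts G // same_component G = components G"
    unfolding same_component_eq_linked[OF assms] by (rule quotient_linked_UNIV[OF assms])
qed (rule partial_order_refinement_order bounded_lattice_refinement_order[OF assms]
    graded_refinement_order[OF assms] least_refinement_order greatest_refinement_order[OF assms])+

end
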